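(* Let $X$ be a centered, nondegenerate, infinitely divisible real random variable with finite variance $V>0$. If $c_*(V)>\max\{0,1/\tau\}$, then $c_*(v)<c_*(V)$ for every $v>V$.
   Context: Standing setting: $X$ is a centered, nondegenerate, infinitely divisible real random variable with variance $0<V=\mathrm{Var}(X)<\infty$, Gaussian variance $a\ge0$ and Lévy measure $\nu$ on $\mathbb{R}\setminus\{0\}$. For all real $t$, $K_X(t)=\log\mathbb{E}e^{tX}=\frac{at^2}{2}+\int_{\mathbb{R}\setminus\{0\}}(e^{tx}-1-tx)\,\nu(dx)\in[0,\infty]$. $\tau=\sup\{t>0:K_X(t)<\infty\}\in[0,\infty]$ (with $\sup\emptyset=0$). Conventions: $1/0=\infty$, $1/\infty=0$ (so the hypothesis excludes $\tau=0$). A pair $(v,c)\in(0,\infty)\times[0,\infty)$ is feasible for $X$ if $K_X(t)\le \frac{vt^2}{2(1-ct)}$ for every $0\le t<1/c$ (for $c=0$: for all $t\ge0$). $c_*(v)=\inf\{c\ge0:(v,c)\text{ is feasible}\}\in[0,\infty]$, with $\inf\emptyset=\infty$. *)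

theory Defs
  imports "HOL-Probability.Probability"
begin

text \<open>
  A random variable is a measurable function on a probability space; \<^term>\<open>distr M borel X\<close> is
  its law.
\<close>

definition nondegenerate :: "'a measure \<Rightarrow> ('a \<Rightarrow> real) \<Rightarrow> bool" where
  "nondegenerate M X \<longleftrightarrow> \<not> (\<exists>c. AE \<omega> in M. X \<omega> = c)"

text \<open>
  Infinite divisibility: for every \<open>n \<ge> 1\<close> the law of \<open>X\<close> is the law of a sum of \<open>n\<close> independent
  identically distributed real random variables. These are realised as the coordinates of the
  \<open>n\<close>-fold product of their common law \<open>\<mu>\<close>; they need not live on the space of \<open>X\<close>.
\<close>

definition infinitely_divisible :: "'a measure \<Rightarrow> ('a \<Rightarrow> real) \<Rightarrow> bool" where
  "infinitely_divisible M X \<longleftrightarrow>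
     (\<forall>n::nat. n \<ge> 1 \<longrightarrow> (\<exists>\<mu>. real_distribution \<mu> \<and>
        distr M borel X = distr (PiM {..<n} (\<lambda>_. \<mu>)) borel (\<lambda>y. \<Sum>i<n. y i)))"

text \<open>
  The cumulant generating function \<open>K\<^sub>X(t) = log E exp(t X)\<close> as an extended real: the
  expectation is a nonnegative integral, so it may be \<open>\<infinity>\<close>, and then so is its logarithm.
\<close>

definition cgf :: "'a measure \<Rightarrow> ('a \<Rightarrow> real) \<Rightarrow> real \<Rightarrow> ereal" where
  "cgf M X t =
     (let m = (\<integral>\<^sup>+ \<omega>. ennreal (exp (t * X \<omega>)) \<partial>M)
      in if m = \<infinity> then \<infinity> else ereal (ln (enn2real m)))"

text \<open>
  In \<^typ>\<open>ennreal\<close> the conventions in force are the library's own: \<open>Sup {} = 0\<close>, \<open>Inf {} = \<infinity>\<close>,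
  \<open>1 / 0 = \<infinity>\<close> and \<open>1 / \<infinity> = 0\<close>.
\<close>

definition cgf_abscissa :: "'a measure \<Rightarrow> ('a \<Rightarrow> real) \<Rightarrow> ennreal" where
  "cgf_abscissa M X = Sup (ennreal ` {t. t > 0 \<and> cgf M X t < \<infinity>})"

definition feasible :: "'a measure \<Rightarrow> ('a \<Rightarrow> real) \<Rightarrow> real \<Rightarrow> real \<Rightarrow> bool" where
  "feasible M X v c \<longleftrightarrow> v > 0 \<and> c \<ge> 0 \<and>
     (\<forall>t\<ge>0. (c = 0 \<or> t < 1 / c) \<longrightarrow> cgf M X t \<le> ereal (v * t\<^sup>2 / (2 * (1 - c * t))))"

definition c_star :: "'a measure \<Rightarrow> ('a \<Rightarrow> real) \<Rightarrow> real \<Rightarrow> ennreal" where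
  "c_star M X v = Inf (ennreal ` {c. c \<ge> 0 \<and> feasible M X v c})"

end

theory Submission
  imports Defs "HOL-Real_Asymp.Real_Asymp"
begin

text \<open>
  Write \<open>K\<close> for the cumulant generating function of \<open>X\<close>; the condition on \<open>1 / \<tau>\<close> forces \<open>K\<close> to
  be finite on some interval to the right of \<open>0\<close>. Since \<open>X\<close> is centered, \<open>K t\<close> is asymptotic to \<open>V * t\<^sup>2 / 2\<close> as \<open>t\<close> decreases to \<open>0\<close>, so the bound with constant \<open>V\<close> is tight
  at the origin. For \<open>v > V\<close> there is room: \<open>K t \<le> v * t\<^sup>2 / 2\<close> on some interval \<open>[0, \<delta>)\<close>,
  for any scale at all (\<open>cgf_le_quadratic_near_0\<close>). Hence \<open>(v, 1 / \<delta>)\<close> is feasible, which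
  settles the case that \<open>V\<close> admits no finite scale.

  Suppose now that the optimal scale \<open>c\<close> for \<open>V\<close> is finite. Away from the origin, going from
  \<open>V\<close> to \<open>v\<close> gains at least \<open>(v - V) * \<delta>\<^sup>2 / 2\<close> in the inequality
  \<open>K t * (1 - c * t) \<le> V * t\<^sup>2 / 2\<close>, and a gain bounded below pays for a small decrease of \<open>c\<close>
  provided that \<open>K t * t\<close> is bounded where the new inequality is required. This is
  where the gap between \<open>c\<close> and \<open>1 / \<tau>\<close> enters: \<open>K s\<close> is finite for some \<open>s > 1 / c\<close>, so every
  scale in \<open>[1 / s, c)\<close> concerns only \<open>t \<le> s\<close>, where \<open>K\<close> is bounded (\<open>cgf_bounded\<close>). The
  trade-off is \<open>feasible_lower_scale\<close>; it is applied to a feasible scale for \<open>V\<close> just above or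
  equal to \<open>c\<close>, and reaches below \<open>c\<close>.
\<close>

section \<open>The cumulant generating function on an interval where it is finite\<close>

lemma cgf_eq_ln_expectation:
  assumes "integrable M (\<lambda>\<omega>. exp (t * X \<omega>))"
  shows "cgf M X t = ereal (ln (\<integral>\<omega>. exp (t * X \<omega>) \<partial>M))"
proof -
  have "(\<integral>\<^sup>+ \<omega>. ennreal (exp (t * X \<omega>)) \<partial>M) = ennreal (\<integral>\<omega>. exp (t * X \<omega>) \<partial>M)"
    by (rule nn_integral_eq_integral[OF assms]) simp
  then show ?thesis
    by (simp add: cgf_def Let_def integral_nonneg_AE)
qed

lemma integrable_exp_if_cgf_finite:
  assumes "X \<in> borel_measurable M" and "cgf M X t < \<infinity>"
  shows "integrable M (\<lambda>\<omega>. exp (t * X \<omega>))"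
proof (rule integrableI_bounded)
  show "(\<lambda>\<omega>. exp (t * X \<omega>)) \<in> borel_measurable M"
    using assms(1) by measurable
  show "(\<integral>\<^sup>+ \<omega>. ennreal (norm (exp (t * X \<omega>))) \<partial>M) < \<infinity>"
    using assms(2) by (auto simp: cgf_def Let_def less_top split: if_splits)
qed

lemma (in prob_space) integrable_exp_mono:
  fixes X :: "'a \<Rightarrow> real"
  assumes "X \<in> borel_measurable M"
    and "integrable M (\<lambda>\<omega>. exp (s * X \<omega>))" and "0 \<le> t" and "t \<le> s"
  shows "integrable M (\<lambda>\<omega>. exp (t * X \<omega>))"
    and "(\<integral>\<omega>. exp (t * X \<omega>) \<partial>M) \<le> 1 + (\<integral>\<omega>. exp (s * X \<omega>) \<partial>M)"
proof -
  have le: "exp (t * x) \<le> 1 + exp (s * x)" for x :: real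
  proof (cases "x \<ge> 0")
    case True
    then have "exp (t * x) \<le> exp (s * x)"
      using assms(4) by (simp add: mult_right_mono)
    also have "\<dots> \<le> 1 + exp (s * x)" by simp
    finally show ?thesis .
  next
    case False
    then have "exp (t * x) \<le> 1"
      using assms(3) by (simp add: mult_nonneg_nonpos)
    then show ?thesis by (simp add: add_increasing2)
  qed
  have int: "integrable M (\<lambda>\<omega>. 1 + exp (s * X \<omega>))"
    using assms(2) by simp
  show *: "integrable M (\<lambda>\<omega>. exp (t * X \<omega>))"
    by (rule Bochner_Integration.integrable_bound[OF int])
      (use assms(1) le in \<open>auto simp: add_nonneg_nonneg\<close>)
  have "(\<integral>\<omega>. exp (t * X \<omega>) \<partial>M) \<le> (\<integral>\<omega>. 1 + exp (s * X \<omega>) \<partial>M)"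
    by (rule integral_mono[OF * int]) (rule le)
  then show "(\<integral>\<omega>. exp (t * X \<omega>) \<partial>M) \<le> 1 + (\<integral>\<omega>. exp (s * X \<omega>) \<partial>M)"
    using assms(2) by (simp add: prob_space)
qed

lemma (in prob_space) expectation_exp_ge_1:
  fixes X :: "'a \<Rightarrow> real"
  assumes "integrable M X" and "expectation X = 0" and "integrable M (\<lambda>\<omega>. exp (t * X \<omega>))"
  shows "1 \<le> expectation (\<lambda>\<omega>. exp (t * X \<omega>))"
proof -
  have "(\<integral>\<omega>. 1 + t * X \<omega> \<partial>M) \<le> (\<integral>\<omega>. exp (t * X \<omega>) \<partial>M)"
    using assms by (intro integral_mono) (auto simp: exp_ge_add_one_self)
  then show ?thesis
    using assms by (simp add: prob_space)
qed

text \<open>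
  The upper bound comes from \<open>exp (t * x) \<le> 1 + exp (s * x)\<close>; the lower bound is Jensen's
  inequality for a centered variable, in the form \<open>1 + t * x \<le> exp (t * x)\<close>.
\<close>

lemma (in prob_space) cgf_bounded:
  fixes X :: "'a \<Rightarrow> real"
  assumes "X \<in> borel_measurable M" and "integrable M X" and "expectation X = 0"
    and "cgf M X s < \<infinity>"
  obtains B where "\<And>t. 0 \<le> t \<Longrightarrow> t \<le> s \<Longrightarrow> \<exists>k. cgf M X t = ereal k \<and> 0 \<le> k \<and> k \<le> B"
proof
  fix t assume t: "0 \<le> t" "t \<le> s"
  define m where "m = (\<integral>\<omega>. exp (t * X \<omega>) \<partial>M)"
  note intS = integrable_exp_if_cgf_finite[OF assms(1,4)]
  note int = integrable_exp_mono[OF assms(1) intS t]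
  have "1 \<le> m"
    unfolding m_def by (rule expectation_exp_ge_1[OF assms(2,3) int(1)])
  then show "\<exists>k. cgf M X t = ereal k \<and> 0 \<le> k \<and> k \<le> ln (1 + (\<integral>\<omega>. exp (s * X \<omega>) \<partial>M))"
    using cgf_eq_ln_expectation[OF int(1)] int(2) unfolding m_def by auto
qed

section \<open>Second-order behaviour at the origin\<close>

text \<open>
  For negative \<open>u\<close> the reciprocal of the lower Taylor bound at \<open>- u\<close> suffices, because
  \<open>(1 + u + u\<^sup>2 / 2) * (1 - u + u\<^sup>2 / 2) = 1 + u ^ 4 / 4\<close>.
\<close>

lemma exp_second_remainder_le:
  fixes u :: real
  shows "exp u - 1 - u \<le> u\<^sup>2 / 2 * (1 + exp u)"
proof (cases "u \<ge> 0")
  case True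
  obtain z where z: "\<bar>z\<bar> \<le> \<bar>u\<bar>" "exp u = 1 + u + exp z / 2 * u\<^sup>2"
    using Maclaurin_exp_le[of u 2] by (auto simp: numeral_2_eq_2)
  have "exp z * u\<^sup>2 \<le> (1 + exp u) * u\<^sup>2"
    using z(1) True by (intro mult_right_mono) (auto intro: add_increasing)
  then show ?thesis
    using z(2) by (simp add: algebra_simps)
next
  case False
  have lower: "1 - u + u\<^sup>2 / 2 \<le> exp (- u)"
    using exp_lower_Taylor_quadratic[of "- u"] False by simp
  have "0 \<le> (1 + u)\<^sup>2 + 1"
    by simp
  then have nonneg: "0 \<le> 1 + u + u\<^sup>2 / 2"
    by (simp add: power2_eq_square algebra_simps)
  have "(1 + u + u\<^sup>2 / 2) * (1 - u + u\<^sup>2 / 2) = 1 + (u\<^sup>2)\<^sup>2 / 4"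
    by (simp add: power2_eq_square algebra_simps)
  then have "1 \<le> (1 + u + u\<^sup>2 / 2) * (1 - u + u\<^sup>2 / 2)"
    by simp
  also have "\<dots> \<le> (1 + u + u\<^sup>2 / 2) * exp (- u)"
    by (rule mult_left_mono[OF lower nonneg])
  finally have "exp u \<le> 1 + u + u\<^sup>2 / 2"
    by (simp add: exp_minus field_simps)
  moreover have "u\<^sup>2 / 2 \<le> u\<^sup>2 / 2 * (1 + exp u)"
    by (simp add: distrib_left)
  ultimately show ?thesis by linarith
qed

text \<open>
  On the positive half-line half of the exponent \<open>s * x\<close> absorbs the factor \<open>x\<^sup>2\<close>, which is
  why \<open>t\<close> stays below \<open>s / 2\<close>; on the negative one \<open>exp (t * x) \<le> 1\<close>.
\<close>

lemma exp_second_remainder_dominated: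
  fixes s t x :: real
  assumes "0 < t" and "t \<le> s / 2"
  shows "\<bar>(exp (t * x) - 1 - t * x) / t\<^sup>2\<bar> \<le> x\<^sup>2 + 4 / s\<^sup>2 * exp (s * x)"
proof -
  have s: "s > 0" using assms by simp
  have exp_le: "x\<^sup>2 * exp (t * x) \<le> x\<^sup>2 + 8 / s\<^sup>2 * exp (s * x)"
  proof (cases "x \<ge> 0")
    case True
    have "(s * x / 2)\<^sup>2 / 2 \<le> exp (s * x / 2)"
      using exp_lower_Taylor_quadratic[of "s * x / 2"] True s by (smt (verit) divide_nonneg_pos mult_nonneg_nonneg)
    then have "x\<^sup>2 \<le> 8 / s\<^sup>2 * exp (s * x / 2)"
      using s by (simp add: field_simps power_mult_distrib)
    moreover have "exp (t * x) \<le> exp (s * x / 2)"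
      using mult_right_mono[OF assms(2) True] by simp
    ultimately have "x\<^sup>2 * exp (t * x) \<le> 8 / s\<^sup>2 * exp (s * x / 2) * exp (s * x / 2)"
      by (intro mult_mono) auto
    also have "\<dots> = 8 / s\<^sup>2 * exp (s * x)"
      by (simp flip: exp_add)
    finally show ?thesis by (simp add: add_increasing)
  next
    case False
    then have "exp (t * x) \<le> 1"
      using assms(1) by (simp add: mult_nonneg_nonpos)
    then have "x\<^sup>2 * exp (t * x) \<le> x\<^sup>2 * 1"
      by (intro mult_left_mono) auto
    then show ?thesis by (simp add: add_increasing2)
  qed
  have "(exp (t * x) - 1 - t * x) / t\<^sup>2 \<le> x\<^sup>2 / 2 * (1 + exp (t * x))"
    using exp_second_remainder_le[of "t * x"] assms(1)
    by (simp add: field_simps power_mult_distrib)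
  also have "\<dots> \<le> x\<^sup>2 + 4 / s\<^sup>2 * exp (s * x)"
    using exp_le by (simp add: algebra_simps)
  finally have "(exp (t * x) - 1 - t * x) / t\<^sup>2 \<le> x\<^sup>2 + 4 / s\<^sup>2 * exp (s * x)" .
  moreover have "0 \<le> (exp (t * x) - 1 - t * x) / t\<^sup>2"
    using exp_ge_add_one_self[of "t * x"] by (intro divide_nonneg_nonneg zero_le_power2) linarith
  ultimately show ?thesis by simp
qed

text \<open>
  The moment generating function may be infinite at every negative argument, so the origin need
  not be interior to its domain and differentiability there is not automatic. Dominated
  convergence still gives a one-sided second-order expansion: the exponential moment controls
  the right tail, the second moment the left one.
\<close>

lemma (in prob_space) mgf_second_order_at_right:
  fixes X :: "'a \<Rightarrow> real"
  assumes "X \<in> borel_measurable M" and "integrable M X" and "expectation X = 0"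
    and "integrable M (\<lambda>\<omega>. (X \<omega>)\<^sup>2)"
    and "s > 0" and "integrable M (\<lambda>\<omega>. exp (s * X \<omega>))"
  shows "((\<lambda>t. (expectation (\<lambda>\<omega>. exp (t * X \<omega>)) - 1) / t\<^sup>2)
            \<longlongrightarrow> expectation (\<lambda>\<omega>. (X \<omega>)\<^sup>2) / 2) (at_right 0)"
proof (rule tendsto_at_right_sequentially)
  show "0 < s / 2" using assms(5) by simp
next
  fix r :: "nat \<Rightarrow> real"
  assume pos: "\<And>n. 0 < r n" and small: "\<And>n. r n < s / 2" and lim: "r \<longlonglongrightarrow> 0"
  have right: "filterlim r (at_right 0) sequentially"
    using lim pos by (auto simp: filterlim_at less_imp_neq[symmetric])
  have pointwise: "(\<lambda>n. (exp (r n * x) - 1 - r n * x) / (r n)\<^sup>2) \<longlonglongrightarrow> x\<^sup>2 / 2" for x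
  proof -
    have "((\<lambda>t. (exp (t * x) - 1 - t * x) / t\<^sup>2) \<longlongrightarrow> x * x / 2) (at_right 0)"
      by real_asymp
    then show ?thesis
      using right by (auto simp: power2_eq_square intro: filterlim_compose)
  qed
  have "(\<lambda>n. \<integral>\<omega>. (exp (r n * X \<omega>) - 1 - r n * X \<omega>) / (r n)\<^sup>2 \<partial>M) \<longlonglongrightarrow> (\<integral>\<omega>. (X \<omega>)\<^sup>2 / 2 \<partial>M)"
  proof (rule integral_dominated_convergence)
    show "integrable M (\<lambda>\<omega>. (X \<omega>)\<^sup>2 + 4 / s\<^sup>2 * exp (s * X \<omega>))"
      using assms(4,6) by simp
    show "AE \<omega> in M. norm ((exp (r n * X \<omega>) - 1 - r n * X \<omega>) / (r n)\<^sup>2)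
            \<le> (X \<omega>)\<^sup>2 + 4 / s\<^sup>2 * exp (s * X \<omega>)" for n
      using exp_second_remainder_dominated[OF pos[of n]] small[of n] by (simp add: less_imp_le)
  qed (use assms(1) pointwise in auto)
  moreover have "(\<integral>\<omega>. (exp (r n * X \<omega>) - 1 - r n * X \<omega>) / (r n)\<^sup>2 \<partial>M)
      = (expectation (\<lambda>\<omega>. exp (r n * X \<omega>)) - 1) / (r n)\<^sup>2" for n
  proof -
    have "integrable M (\<lambda>\<omega>. exp (r n * X \<omega>))"
      using integrable_exp_mono(1)[OF assms(1,6)] pos[of n] small[of n] assms(5)
      by (simp add: less_imp_le)
    then show ?thesis
      using assms(2,3) by (subst integral_divide_zero) (simp add: prob_space)
  qed
  ultimately show "(\<lambda>n. (expectation (\<lambda>\<omega>. exp (r n * X \<omega>)) - 1) / (r n)\<^sup>2)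
      \<longlonglongrightarrow> expectation (\<lambda>\<omega>. (X \<omega>)\<^sup>2) / 2"
    by (simp only: integral_divide_zero)
qed

lemma (in prob_space) cgf_le_quadratic_near_0:
  fixes X :: "'a \<Rightarrow> real"
  assumes "X \<in> borel_measurable M" and "integrable M X" and "expectation X = 0"
    and "integrable M (\<lambda>\<omega>. (X \<omega>)\<^sup>2)"
    and "s > 0" and "cgf M X s < \<infinity>" and "expectation (\<lambda>\<omega>. (X \<omega>)\<^sup>2) < v"
  obtains \<delta> where "\<delta> > 0"
    and "\<And>t. 0 \<le> t \<Longrightarrow> t < \<delta> \<Longrightarrow> cgf M X t \<le> ereal (v * t\<^sup>2 / 2)"
proof -
  define m where "m = (\<lambda>t. expectation (\<lambda>\<omega>. exp (t * X \<omega>)))"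
  note int_s = integrable_exp_if_cgf_finite[OF assms(1,6)]
  have "eventually (\<lambda>t. (m t - 1) / t\<^sup>2 < v / 2) (at_right 0)"
    unfolding m_def
    by (rule order_tendstoD(2)[OF mgf_second_order_at_right[OF assms(1-5) int_s]])
      (use assms(7) in simp)
  then obtain d where d: "d > 0" "\<And>t. 0 < t \<Longrightarrow> t < d \<Longrightarrow> (m t - 1) / t\<^sup>2 < v / 2"
    unfolding eventually_at_right_field by blast
  have "cgf M X t \<le> ereal (v * t\<^sup>2 / 2)" if t: "0 \<le> t" "t < min d s" for t
  proof (cases "t = 0")
    case True
    then show ?thesis
      using cgf_eq_ln_expectation[of M 0 X] by (simp add: prob_space)
  next
    case False
    then have "m t - 1 \<le> v * t\<^sup>2 / 2"
      using d(2)[of t] t by (simp add: field_simps)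
    moreover have int: "integrable M (\<lambda>\<omega>. exp (t * X \<omega>))"
      using integrable_exp_mono(1)[OF assms(1) int_s] t by simp
    moreover have "0 < m t"
      using expectation_exp_ge_1[OF assms(2,3) int] unfolding m_def by linarith
    then have "ln (m t) \<le> m t - 1"
      by (rule ln_le_minus_one)
    ultimately show ?thesis
      using cgf_eq_ln_expectation[of M t X] by (simp add: m_def)
  qed
  then show ?thesis
    using d(1) assms(5) by (intro that[of "min d s"]) auto
qed

section \<open>Lowering the scale parameter\<close>

lemma feasible_if_quadratic_bound:
  assumes "v > 0" and "\<delta> > 0"
    and "\<And>t. 0 \<le> t \<Longrightarrow> t < \<delta> \<Longrightarrow> cgf M X t \<le> ereal (v * t\<^sup>2 / 2)"
  shows "feasible M X v (1 / \<delta>)"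
  unfolding feasible_def
proof (intro conjI allI impI)
  fix t :: real
  assume t: "0 \<le> t" "1 / \<delta> = 0 \<or> t < 1 / (1 / \<delta>)"
  then have "v * t\<^sup>2 / 2 \<le> v * t\<^sup>2 / (2 * (1 - 1 / \<delta> * t))"
    using assms(1,2) by (intro divide_left_mono) (auto simp: field_simps)
  then show "cgf M X t \<le> ereal (v * t\<^sup>2 / (2 * (1 - 1 / \<delta> * t)))"
    using assms(2) t by (intro order_trans[OF assms(3)]) (auto simp del: times_divide_eq_left)
qed (use assms in auto)

text \<open>
  In the form \<open>K t * (1 - c * t) \<le> V * t\<^sup>2 / 2\<close> the feasibility inequality also holds trivially
  beyond \<open>1 / c\<close>, since the cumulant generating function is nonnegative, so it survives
  on the slightly longer range that a smaller \<open>c'\<close> demands. The cost of passing to \<open>c'\<close> is at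
  most \<open>B * s * (c - c')\<close>, which away from the origin is absorbed by the gain
  \<open>(v - V) * t\<^sup>2 / 2\<close>; near the origin the quadratic bound takes over.
\<close>

lemma feasible_lower_scale:
  assumes "feasible M X V c" and "V < v"
    and "\<delta> > 0" and quad: "\<And>t. 0 \<le> t \<Longrightarrow> t < \<delta> \<Longrightarrow> cgf M X t \<le> ereal (v * t\<^sup>2 / 2)"
    and "s > 0" and bdd: "\<And>t. 0 \<le> t \<Longrightarrow> t \<le> s \<Longrightarrow> \<exists>k. cgf M X t = ereal k \<and> 0 \<le> k \<and> k \<le> B"
    and "1 / s \<le> c'" and "c' \<le> c" and "B * s * (c - c') \<le> (v - V) * \<delta>\<^sup>2 / 2"
  shows "feasible M X v c'"
  unfolding feasible_def
proof (intro conjI allI impI)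
  have "V > 0" using assms(1) by (simp add: feasible_def)
  then show v: "v > 0" using assms(2) by simp
  have "0 < 1 / s" using assms(5) by simp
  then have c': "c' > 0" using assms(7) by linarith
  then show "c' \<ge> 0" by simp
  fix t :: real
  assume t: "0 \<le> t" and "c' = 0 \<or> t < 1 / c'"
  then have tc': "t < 1 / c'" using c' by simp
  then have pos: "0 < 1 - c' * t" using c' by (simp add: field_simps)
  have "1 / c' \<le> s" using assms(5,7) c' by (simp add: field_simps)
  then have ts: "t \<le> s" using tc' by simp
  obtain k where k: "cgf M X t = ereal k" "0 \<le> k" "k \<le> B"
    using bdd[OF t ts] by blast
  have "k * (1 - c' * t) \<le> v * t\<^sup>2 / 2"
  proof (cases "t < \<delta>")
    case True
    have "k * (1 - c' * t) \<le> k * 1"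
      using k(2) t c' by (intro mult_left_mono) auto
    then show ?thesis using quad[OF t True] k(1) by simp
  next
    case False
    have "k * (1 - c * t) \<le> V * t\<^sup>2 / 2"
    proof (cases "t < 1 / c")
      case True
      have c: "c > 0" using c' assms(8) by simp
      then have "0 < 1 - c * t" using True by (simp add: field_simps)
      moreover have "k \<le> V * t\<^sup>2 / (2 * (1 - c * t))"
        using assms(1) t True k(1) by (auto simp: feasible_def)
      ultimately show ?thesis by (simp add: field_simps)
    next
      case False
      have "c > 0" using c' assms(8) by simp
      then have "1 - c * t \<le> 0" using False by (simp add: field_simps)
      then have "k * (1 - c * t) \<le> 0" using k(2) by (rule mult_nonneg_nonpos[rotated])
      also have "0 \<le> V * t\<^sup>2 / 2" using \<open>V > 0\<close> by simp
      finally show ?thesis .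
    qed
    moreover have "k * (t * (c - c')) \<le> B * (s * (c - c'))"
      using k ts t assms(8) by (intro mult_mono mult_right_mono) auto
    moreover have "(v - V) * \<delta>\<^sup>2 / 2 \<le> (v - V) * t\<^sup>2 / 2"
      using False assms(2,3) by (intro divide_right_mono mult_left_mono power_mono) auto
    moreover have "k * (1 - c' * t) = k * (1 - c * t) + k * (t * (c - c'))"
      and "V * t\<^sup>2 / 2 + (v - V) * t\<^sup>2 / 2 = v * t\<^sup>2 / 2"
      by (simp_all add: field_simps)
    ultimately show ?thesis
      using assms(9) unfolding mult.assoc[of B s] by linarith
  qed
  then have "k \<le> v * t\<^sup>2 / (2 * (1 - c' * t))"
    using pos by (simp add: field_simps)
  then show "cgf M X t \<le> ereal (v * t\<^sup>2 / (2 * (1 - c' * t)))"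
    using k(1) by simp
qed

lemma c_star_le:
  assumes "feasible M X v c"
  shows "c_star M X v \<le> ennreal c"
  unfolding c_star_def using assms by (intro Inf_lower) (auto simp: feasible_def)

lemma finite_cgf_beyond_reciprocal:
  assumes "1 / cgf_abscissa M X < ennreal c" and "c > 0"
  obtains s where "s > 1 / c" and "cgf M X s < \<infinity>"
proof -
  have "ennreal (1 / c) < cgf_abscissa M X"
  proof (cases "cgf_abscissa M X")
    case (real r)
    show ?thesis
    proof (cases "r = 0")
      case True
      then show ?thesis using assms(1) real by simp
    next
      case False
      then have "1 / r < c"
        using assms(1) real divide_ennreal[of 1 r] by (simp add: ennreal_less_iff)
      then show ?thesis
        using real False assms(2) by (simp add: ennreal_less_iff field_simps)
    qed
  qed simp
  then show ?thesis
    using assms(2) that unfolding cgf_abscissa_def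
    by (auto simp: less_Sup_iff ennreal_less_iff)
qed

theorem theorem4p5:
  fixes M :: "'a measure" and X :: "'a \<Rightarrow> real" and V :: real
  assumes "prob_space M"
    and "X \<in> borel_measurable M"
    and "infinitely_divisible M X"
    and "nondegenerate M X"
    and "integrable M X" and "prob_space.expectation M X = 0"
    and "integrable M (\<lambda>\<omega>. (X \<omega>)\<^sup>2)"
    and "V = prob_space.variance M X" and "V > 0"
    and "c_star M X V > max 0 (1 / cgf_abscissa M X)"
  shows "\<forall>v>V. c_star M X v < c_star M X V"
proof (intro allI impI)
  fix v assume "V < v"
  interpret prob_space M by fact
  have V: "expectation (\<lambda>\<omega>. (X \<omega>)\<^sup>2) = V"
    using assms(6,8) by simp
  show "c_star M X v < c_star M X V"
  proof (cases "c_star M X V = \<infinity>")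
    case True
    then obtain c where "1 / cgf_abscissa M X < ennreal c" "c > 0"
    proof -
      have "1 / cgf_abscissa M X < \<infinity>"
        using assms(10) True by simp
      then show ?thesis
        by (intro that[of "enn2real (1 / cgf_abscissa M X) + 1"])
          (auto simp: ennreal_plus less_top intro: add_nonneg_pos)
    qed
    then obtain s where s: "s > 1 / c" "cgf M X s < \<infinity>"
      by (rule finite_cgf_beyond_reciprocal)
    moreover have "0 < 1 / c" using \<open>c > 0\<close> by simp
    ultimately have "s > 0" by linarith
    obtain \<delta> where \<delta>: "\<delta> > 0" "\<And>t. 0 \<le> t \<Longrightarrow> t < \<delta> \<Longrightarrow> cgf M X t \<le> ereal (v * t\<^sup>2 / 2)"
      using cgf_le_quadratic_near_0[OF assms(2,5,6,7) \<open>s > 0\<close> s(2)] V \<open>V < v\<close> by metis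
    then have "c_star M X v \<le> ennreal (1 / \<delta>)"
      using assms(9) \<open>V < v\<close> by (intro c_star_le feasible_if_quadratic_bound) auto
    then show ?thesis
      using True by (simp add: less_top le_less_trans)
  next
    case False
    define c where "c = enn2real (c_star M X V)"
    have c_eq: "c_star M X V = ennreal c"
      using False by (simp add: c_def less_top)
    have c: "c > 0" "1 / cgf_abscissa M X < ennreal c"
      using assms(10) unfolding c_eq max_less_iff_conj ennreal_less_zero_iff by blast+
    obtain s where s: "s > 1 / c" "cgf M X s < \<infinity>"
      using finite_cgf_beyond_reciprocal[OF c(2,1)] by blast
    have "0 < 1 / c" using c(1) by simp
    with s(1) have "s > 0" by linarith
    obtain \<delta> where \<delta>: "\<delta> > 0" "\<And>t. 0 \<le> t \<Longrightarrow> t < \<delta> \<Longrightarrow> cgf M X t \<le> ereal (v * t\<^sup>2 / 2)"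
      using cgf_le_quadratic_near_0[OF assms(2,5,6,7) \<open>s > 0\<close> s(2)] V \<open>V < v\<close> by metis
    obtain B where B: "\<And>t. 0 \<le> t \<Longrightarrow> t \<le> s \<Longrightarrow> \<exists>k. cgf M X t = ereal k \<and> 0 \<le> k \<and> k \<le> B"
      using cgf_bounded[OF assms(2,5,6) s(2)] by blast
    have "B \<ge> 0" using B[of 0] \<open>s > 0\<close> by force
    define \<eta> where "\<eta> = (v - V) * \<delta>\<^sup>2 / 2"
    have "\<eta> > 0" using \<open>V < v\<close> \<delta>(1) by (simp add: \<eta>_def)
    \<comment> \<open>The feasible scale may exceed \<open>c\<close> by \<open>\<epsilon>\<close> and the new one falls short of it by as much,
      so the loss is at most \<open>B * s * (2 * \<epsilon>)\<close>; the other term keeps \<open>1 / (c - \<epsilon>)\<close> within \<open>s\<close>.\<close>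
    define \<epsilon> where "\<epsilon> = min (c - 1 / s) (\<eta> / (2 * s * (B + 1)))"
    have "1 / s < c" using s(1) c(1) \<open>s > 0\<close> by (simp add: field_simps)
    then have "\<epsilon> > 0"
      using \<open>\<eta> > 0\<close> \<open>s > 0\<close> \<open>B \<ge> 0\<close> by (simp add: \<epsilon>_def)
    have "c_star M X V < ennreal (c + \<epsilon>)"
      using c(1) \<open>\<epsilon> > 0\<close> by (simp add: c_eq ennreal_less_iff)
    then obtain c1 where c1: "feasible M X V c1" "c1 < c + \<epsilon>"
      using c(1) \<open>\<epsilon> > 0\<close> unfolding c_star_def
      by (auto simp: Inf_less_iff ennreal_less_iff simp del: ennreal_plus)
    have "c \<le> c1"
      using c_star_le[OF c1(1)] c1(1) by (simp add: c_eq feasible_def)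
    have "feasible M X v (c - \<epsilon>)"
    proof (rule feasible_lower_scale[OF c1(1) \<open>V < v\<close> \<delta> \<open>s > 0\<close> B])
      show "1 / s \<le> c - \<epsilon>" by (simp add: \<epsilon>_def)
      show "c - \<epsilon> \<le> c1" using \<open>c \<le> c1\<close> \<open>\<epsilon> > 0\<close> by simp
      have "B * s * (c1 - (c - \<epsilon>)) \<le> (B + 1) * s * (2 * \<epsilon>)"
        using c1(2) \<open>c \<le> c1\<close> \<open>\<epsilon> > 0\<close> \<open>B \<ge> 0\<close> \<open>s > 0\<close> by (intro mult_mono) auto
      also have "\<dots> = \<epsilon> * (2 * s * (B + 1))" by simp
      also have "\<dots> \<le> \<eta> / (2 * s * (B + 1)) * (2 * s * (B + 1))"
        using \<open>B \<ge> 0\<close> \<open>s > 0\<close> by (intro mult_right_mono) (auto simp: \<epsilon>_def)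
      also have "\<dots> = \<eta>" using \<open>B \<ge> 0\<close> \<open>s > 0\<close> by simp
      finally show "B * s * (c1 - (c - \<epsilon>)) \<le> (v - V) * \<delta>\<^sup>2 / 2" by (simp add: \<eta>_def)
    qed
    then have "c_star M X v \<le> ennreal (c - \<epsilon>)"
      by (rule c_star_le)
    also have "\<dots> < c_star M X V"
      using c(1) \<open>\<epsilon> > 0\<close> by (simp add: c_eq ennreal_less_iff ennreal_lessI)
    finally show ?thesis .
  qed
qed

end
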